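(* For every instance of the problem $F2\,|\,p_j=1,\,CD\,|\,C_{\max}$, let $C_{\max}^{*}$ be the length of an optimal schedule and let $C_{\max}^{Gr}$ be the length of the schedule produced by algorithm $Gr$. Let $\pi$ be the sequence of the operations $A_i$ constructed by algorithm $Gr$, and let $q$ be the smallest index in $\{1,\ldots,n\}$ for which $$\sum_{i=1}^{q} d_{\pi_i}^A > \sum_{i=1}^{n} d_{\pi_i}^A - m .$$ Then $$\frac{C_{\max}^{Gr}}{C_{\max}^{*}} \le \frac{\max\{q+m,\;n\}}{\max\{m+d_{\min}^B,\;n+d_{\min}^A\}},$$ where $d_{\min}^A=\min_{i=1,\ldots,n} d_i^A$ and $d_{\min}^B=\min_{j=1,\ldots,m} d_j^B$.
   Context: Problem $F2\,|\,p_j=1,\,CD\,|\,C_{\max}$. There are operations $V_1=\{A_1,\ldots,A_n\}$, performed on machine $M_1$, and $V_2=\{B_1,\ldots,B_m\}$, performed on machine $M_2$ ($n,m\ge 1$). Every operation has duration $1$. Preemption is not allowed, and a machine cannot perform two operations at the same time. Precedence is given by a directed bipartite graph $G=(V_1\cup V_2,E)$, where an arc $(A_i,B_j)\in E$ means that $B_j$ cannot start before $A_i$ is completed. A schedule is given by start times $s_i^A\ge 0$ of $A_i$ and $s_j^B\ge 0$ of $B_j$; it is feasible if, in addition to the machine constraints, every $B_j$ starts no earlier than the completion of all $A_i$ with $(A_i,B_j)\in E$. The length of a schedule is $C_{\max}=\max\{\max_i (s_i^A+1),\max_j (s_j^B+1)\}$, and an optimal schedule is a feasible schedule of minimum length.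 Let $S_i=\{j : (A_i,B_j)\in E\}$, $T_j=\{i : (A_i,B_j)\in E\}$, $d_i^A=|S_i|$, $d_j^B=|T_j|$. Algorithm $Gr$. Order the operations $A_i$ by non-increasing $d_i^A$; operations with equal $d_i^A$ are ordered by non-increasing $d_i^A/\sum_{j\in S_i} d_j^B$ (remaining ties are broken arbitrarily). This gives a sequence $\pi=(\pi_1,\ldots,\pi_n)$ of indices; set $s_{\pi_i}^A=i-1$ for $i=1,\ldots,n$. For each $j$ compute the release time $r_j=\max\{d_j^B,\max_{i\in T_j}(s_i^A+1)\}$ (with $r_j=0$ if $T_j=\emptyset$). Sort the operations $B_j$ by non-decreasing $r_j$ and perform them on $M_2$ in this order, each as early as possible subject to $s_j^B\ge r_j$ and to the availability of $M_2$. *)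

theory Defs
  imports Complex_Main
begin

text \<open>
  Operations are represented by their indices: \<open>A\<^sub>1, \<dots>, A\<^sub>n\<close> by \<open>{1..n}\<close>, \<open>B\<^sub>1, \<dots>, B\<^sub>m\<close> by
  \<open>{1..m}\<close>; the pair \<open>(i, j) \<in> E\<close> is the arc from \<open>A\<^sub>i\<close> to \<open>B\<^sub>j\<close>.
\<close>

definition cd_instance :: "nat \<Rightarrow> nat \<Rightarrow> (nat \<times> nat) set \<Rightarrow> bool" where
  "cd_instance n m E \<longleftrightarrow> 1 \<le> n \<and> 1 \<le> m \<and> E \<subseteq> {1..n} \<times> {1..m}"

definition succs :: "(nat \<times> nat) set \<Rightarrow> nat \<Rightarrow> nat set" where
  "succs E i = {j. (i, j) \<in> E}"

definition preds :: "(nat \<times> nat) set \<Rightarrow> nat \<Rightarrow> nat set" where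
  "preds E j = {i. (i, j) \<in> E}"

definition degA :: "(nat \<times> nat) set \<Rightarrow> nat \<Rightarrow> nat" where
  "degA E i = card (succs E i)"

definition degB :: "(nat \<times> nat) set \<Rightarrow> nat \<Rightarrow> nat" where
  "degB E j = card (preds E j)"

definition dminA :: "nat \<Rightarrow> (nat \<times> nat) set \<Rightarrow> nat" where
  "dminA n E = Min (degA E ` {1..n})"

definition dminB :: "nat \<Rightarrow> (nat \<times> nat) set \<Rightarrow> nat" where
  "dminB m E = Min (degB E ` {1..m})"


definition machine_ok :: "nat \<Rightarrow> (nat \<Rightarrow> real) \<Rightarrow> bool" where
  "machine_ok k s \<longleftrightarrow> (\<forall>i\<in>{1..k}. 0 \<le> s i) \<and>
     (\<forall>i\<in>{1..k}. \<forall>j\<in>{1..k}. i \<noteq> j \<longrightarrow> s i + 1 \<le> s j \<or> s j + 1 \<le> s i)"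

definition feasible ::
  "nat \<Rightarrow> nat \<Rightarrow> (nat \<times> nat) set \<Rightarrow> (nat \<Rightarrow> real) \<Rightarrow> (nat \<Rightarrow> real) \<Rightarrow> bool" where
  "feasible n m E sA sB \<longleftrightarrow>
     machine_ok n sA \<and> machine_ok m sB \<and> (\<forall>(i, j)\<in>E. sA i + 1 \<le> sB j)"

definition Cmax :: "nat \<Rightarrow> nat \<Rightarrow> (nat \<Rightarrow> real) \<Rightarrow> (nat \<Rightarrow> real) \<Rightarrow> real" where
  "Cmax n m sA sB = max (Max ((\<lambda>i. sA i + 1) ` {1..n})) (Max ((\<lambda>j. sB j + 1) ` {1..m}))"

definition optimal ::
  "nat \<Rightarrow> nat \<Rightarrow> (nat \<times> nat) set \<Rightarrow> (nat \<Rightarrow> real) \<Rightarrow> (nat \<Rightarrow> real) \<Rightarrow> bool" where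
  "optimal n m E sA sB \<longleftrightarrow> feasible n m E sA sB \<and>
     (\<forall>tA tB. feasible n m E tA tB \<longrightarrow> Cmax n m sA sB \<le> Cmax n m tA tB)"


text \<open>
  For \<open>S\<^sub>i = {}\<close> the quotient below is \<open>0 / 0 = 0\<close>; it is then compared only with other
  operations of degree \<open>0\<close>, so they may come in any order.
\<close>

definition ratioA :: "(nat \<times> nat) set \<Rightarrow> nat \<Rightarrow> real" where
  "ratioA E i = real (degA E i) / real (\<Sum>j\<in>succs E i. degB E j)"

text \<open>
  Algorithm \<open>Gr\<close> breaks ties arbitrarily, so its steps are relations: they hold for every
  order and every schedule the algorithm may produce.
\<close>

definition Gr_order :: "nat \<Rightarrow> (nat \<times> nat) set \<Rightarrow> (nat \<Rightarrow> nat) \<Rightarrow> bool" where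
  "Gr_order n E \<pi> \<longleftrightarrow> bij_betw \<pi> {1..n} {1..n} \<and>
     (\<forall>a\<in>{1..n}. \<forall>b\<in>{1..n}. a < b \<longrightarrow>
        degA E (\<pi> b) \<le> degA E (\<pi> a) \<and>
        (degA E (\<pi> a) = degA E (\<pi> b) \<longrightarrow> ratioA E (\<pi> b) \<le> ratioA E (\<pi> a)))"

definition release :: "(nat \<times> nat) set \<Rightarrow> (nat \<Rightarrow> real) \<Rightarrow> nat \<Rightarrow> real" where
  "release E sA j = (if preds E j = {} then 0
     else max (real (degB E j)) (Max ((\<lambda>i. sA i + 1) ` preds E j)))"

text \<open>
  \<open>M\<^sub>2\<close> becomes available for the \<open>k\<close>-th operation at time \<open>0\<close> if \<open>k = 1\<close>, and at the
  completion of the \<open>(k - 1)\<close>-st operation otherwise.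
\<close>

definition Gr_scheduleB ::
  "nat \<Rightarrow> (nat \<times> nat) set \<Rightarrow> (nat \<Rightarrow> real) \<Rightarrow> (nat \<Rightarrow> real) \<Rightarrow> bool" where
  "Gr_scheduleB m E sA sB \<longleftrightarrow> (\<exists>\<sigma>. bij_betw \<sigma> {1..m} {1..m} \<and>
     (\<forall>a\<in>{1..m}. \<forall>b\<in>{1..m}. a < b \<longrightarrow> release E sA (\<sigma> a) \<le> release E sA (\<sigma> b)) \<and>
     (\<forall>k\<in>{1..m}. sB (\<sigma> k) =
        max (release E sA (\<sigma> k)) (if k = 1 then 0 else sB (\<sigma> (k - 1)) + 1)))"

definition Gr_schedule ::
  "nat \<Rightarrow> nat \<Rightarrow> (nat \<times> nat) set \<Rightarrow> (nat \<Rightarrow> nat) \<Rightarrow> (nat \<Rightarrow> real) \<Rightarrow> (nat \<Rightarrow> real) \<Rightarrow> bool" where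
  "Gr_schedule n m E \<pi> sA sB \<longleftrightarrow>
     Gr_order n E \<pi> \<and> (\<forall>i\<in>{1..n}. sA (\<pi> i) = real i - 1) \<and> Gr_scheduleB m E sA sB"

text \<open>
  The inequality is over the integers, because the right-hand side may be negative. The least
  element exists for \<open>n, m \<ge> 1\<close>, since \<open>q = n\<close> satisfies the condition.
\<close>

definition q_index :: "nat \<Rightarrow> nat \<Rightarrow> (nat \<times> nat) set \<Rightarrow> (nat \<Rightarrow> nat) \<Rightarrow> nat" where
  "q_index n m E \<pi> = (LEAST q. q \<in> {1..n} \<and>
     (\<Sum>i=1..q. int (degA E (\<pi> i))) > (\<Sum>i=1..n. int (degA E (\<pi> i))) - int m)"


text \<open>Rounding start times down preserves feasibility, so the minimum length is attained.\<close>

lemma ex_optimal: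
  assumes "cd_instance n m E"
  shows "\<exists>sA sB. optimal n m E sA sB"
proof -
  define fl :: "(nat \<Rightarrow> real) \<Rightarrow> nat \<Rightarrow> real" where "fl s = (\<lambda>i. of_int \<lfloor>s i\<rfloor>)" for s
  define P where "P k \<longleftrightarrow> (\<exists>sA sB. feasible n m E sA sB \<and> Cmax n m sA sB \<le> real k)" for k
  have nm: "1 \<le> n" "1 \<le> m" and E: "E \<subseteq> {1..n} \<times> {1..m}"
    using assms by (auto simp: cd_instance_def)
  have C_le: "Cmax n m sA sB \<le> c \<longleftrightarrow> (\<forall>i\<in>{1..n}. sA i + 1 \<le> c) \<and> (\<forall>j\<in>{1..m}. sB j + 1 \<le> c)"
    for sA sB c using nm by (auto simp: Cmax_def)
  have fl_le: "fl s i \<le> s i" for s i by (simp add: fl_def)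
  have floor_step: "of_int \<lfloor>a\<rfloor> + 1 \<le> (of_int \<lfloor>b\<rfloor> :: real)" if "a + 1 \<le> b" for a b :: real
    using floor_mono[OF that] by simp
  have fl_step: "s i + 1 \<le> t j \<Longrightarrow> fl s i + 1 \<le> fl t j" for s t i j
    unfolding fl_def by (rule floor_step)
  have fl_nonneg: "0 \<le> s i \<Longrightarrow> 0 \<le> fl s i" for s i by (simp add: fl_def)
  have fl_feas: "feasible n m E (fl sA) (fl sB)" if "feasible n m E sA sB" for sA sB
  proof -
    have machine: "machine_ok k (fl s)" if "machine_ok k s" for k s
      using that fl_step[of s _ s] fl_nonneg unfolding machine_ok_def by meson
    show ?thesis
      using that machine fl_step[of sA _ sB] unfolding feasible_def by fast
  qed
  have round: "\<exists>k. real k \<le> Cmax n m sA sB \<and> P k" if f: "feasible n m E sA sB" for sA sB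
  proof -
    let ?C = "Cmax n m sA sB"
    have le: "\<forall>i\<in>{1..n}. sA i + 1 \<le> ?C" "\<forall>j\<in>{1..m}. sB j + 1 \<le> ?C"
      using C_le[of sA sB ?C] by auto
    have "0 \<le> sA 1" using f nm by (auto simp: feasible_def machine_ok_def)
    then have C0: "0 \<le> ?C" using le(1) nm by force
    have "fl s i + 1 \<le> of_int \<lfloor>?C\<rfloor>" if "s i + 1 \<le> ?C" for s i
      using that unfolding fl_def by (rule floor_step)
    then have "Cmax n m (fl sA) (fl sB) \<le> real (nat \<lfloor>?C\<rfloor>)"
      using C_le le C0 by auto
    moreover have "real (nat \<lfloor>?C\<rfloor>) \<le> ?C" using C0 by simp
    ultimately show ?thesis using fl_feas[OF f] P_def by blast
  qed
  have "feasible n m E (\<lambda>i. real i) (\<lambda>j. real (n + j))"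
    using E by (fastforce simp: feasible_def machine_ok_def)
  then have "\<exists>k. P k" using round by blast
  then have "P (LEAST k. P k)" by (rule LeastI_ex)
  then obtain sA sB where s: "feasible n m E sA sB" "Cmax n m sA sB \<le> real (LEAST k. P k)"
    unfolding P_def by blast
  have "Cmax n m sA sB \<le> Cmax n m tA tB" if "feasible n m E tA tB" for tA tB
  proof -
    obtain k where k: "real k \<le> Cmax n m tA tB" "P k" using round \<open>feasible n m E tA tB\<close> by blast
    have "(LEAST k. P k) \<le> k" using k(2) by (rule Least_le)
    then show ?thesis using s(2) k(1) by linarith
  qed
  then show ?thesis using s(1) unfolding optimal_def by blast
qed

lemma ex_sorting:
  fixes le :: "nat \<Rightarrow> nat \<Rightarrow> bool"
  assumes total: "\<And>x y. le x y \<or> le y x" and trans: "\<And>x y z. le x y \<Longrightarrow> le y z \<Longrightarrow> le x z"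
  shows "\<exists>\<pi>. bij_betw \<pi> {1..k} {1..k} \<and>
    (\<forall>a\<in>{1..k}. \<forall>b\<in>{1..k}. a < b \<longrightarrow> le (\<pi> a) (\<pi> b))"
proof -
  have ins: "\<exists>ys. distinct ys \<and> set ys = insert x (set xs) \<and> sorted_wrt le ys"
    if "sorted_wrt le xs" "distinct xs" "x \<notin> set xs" for x xs
    using that
  proof (induction xs)
    case Nil
    then show ?case by (intro exI[of _ "[x]"]) auto
  next
    case (Cons y xs)
    show ?case
    proof (cases "le x y")
      case True
      then show ?thesis using Cons.prems trans by (intro exI[of _ "x # y # xs"]) auto
    next
      case False
      then have "le y x" using total by blast
      moreover obtain ys where "distinct ys" "set ys = insert x (set xs)" "sorted_wrt le ys"
        using Cons by auto
      ultimately show ?thesis using Cons.prems by (intro exI[of _ "y # ys"]) auto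
    qed
  qed
  have "\<exists>xs. distinct xs \<and> set xs = A \<and> sorted_wrt le xs" if "finite A" for A
    using that
  proof (induction A rule: finite_induct)
    case empty
    show ?case by (intro exI[of _ "[]"]) auto
  next
    case (insert x A)
    then obtain xs where "distinct xs" "set xs = A" "sorted_wrt le xs" by blast
    then show ?case using ins[of xs x] insert.hyps(2) by simp
  qed
  then obtain xs where xs: "distinct xs" "set xs = {1..k}" "sorted_wrt le xs"
    by (meson finite_atLeastAtMost)
  have len: "length xs = k" using distinct_card[OF xs(1)] xs(2) by simp
  define \<pi> where "\<pi> a = xs ! (a - 1)" for a
  have "inj_on \<pi> {1..k}"
    using xs(1) len by (auto simp: inj_on_def \<pi>_def nth_eq_iff_index_eq)
  moreover have "\<pi> ` {1..k} \<subseteq> {1..k}"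
  proof
    fix y assume "y \<in> \<pi> ` {1..k}"
    then obtain a where "a \<in> {1..k}" "y = xs ! (a - 1)" by (auto simp: \<pi>_def)
    then have "y \<in> set xs" using len by auto
    then show "y \<in> {1..k}" using xs(2) by simp
  qed
  ultimately have "bij_betw \<pi> {1..k} {1..k}"
    by (simp add: bij_betw_def endo_inj_surj)
  moreover have "\<forall>a\<in>{1..k}. \<forall>b\<in>{1..k}. a < b \<longrightarrow> le (\<pi> a) (\<pi> b)"
    using xs(3) len by (auto simp: \<pi>_def sorted_wrt_iff_nth_less)
  ultimately show ?thesis by blast
qed

lemma ex_Gr_schedule: "\<exists>\<pi> sA sB. Gr_schedule n m E \<pi> sA sB"
proof -
  define le where "le x y \<longleftrightarrow> degA E y < degA E x \<or>
    degA E y = degA E x \<and> ratioA E y \<le> ratioA E x" for x y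
  obtain \<pi> where pi: "bij_betw \<pi> {1..n} {1..n}"
    "\<forall>a\<in>{1..n}. \<forall>b\<in>{1..n}. a < b \<longrightarrow> le (\<pi> a) (\<pi> b)"
    using ex_sorting[of le n] unfolding le_def by force
  have order: "Gr_order n E \<pi>"
    using pi unfolding Gr_order_def le_def by fastforce
  define sA where "sA i = real (inv_into {1..n} \<pi> i) - 1" for i
  have sA: "\<forall>i\<in>{1..n}. sA (\<pi> i) = real i - 1"
    using pi(1) by (simp add: sA_def bij_betw_def)
  let ?r = "release E sA"
  obtain \<sigma> where sig: "bij_betw \<sigma> {1..m} {1..m}"
    "\<forall>a\<in>{1..m}. \<forall>b\<in>{1..m}. a < b \<longrightarrow> ?r (\<sigma> a) \<le> ?r (\<sigma> b)"
    using ex_sorting[of "\<lambda>x y. ?r x \<le> ?r y" m] by force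
  define f where "f = rec_nat 0 (\<lambda>k x. max (?r (\<sigma> (Suc k))) (if k = 0 then 0 else x + 1))"
  define sB where "sB j = f (inv_into {1..m} \<sigma> j)" for j
  have sB: "sB (\<sigma> k) = f k" if "k \<in> {1..m}" for k
    using that sig(1) by (simp add: sB_def bij_betw_def)
  have "sB (\<sigma> k) = max (?r (\<sigma> k)) (if k = 1 then 0 else sB (\<sigma> (k - 1)) + 1)"
    if "k \<in> {1..m}" for k
    using that sB[of k] sB[of "k - 1"] by (cases k) (auto simp: f_def)
  then have "Gr_scheduleB m E sA sB" using sig unfolding Gr_scheduleB_def by blast
  then show ?thesis using order sA unfolding Gr_schedule_def by blast
qed

end

theory Submission
  imports Defs
begin

text \<open>
  Lower bound: the first operation on \<open>M\<^sub>2\<close> waits for at least \<open>dminB\<close> operations on \<open>M\<^sub>1\<close>, and the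
  last operation on \<open>M\<^sub>1\<close> is followed by at least \<open>dminA\<close> operations on \<open>M\<^sub>2\<close>.

  Upper bound: an operation \<open>B\<^sub>j\<close> that is not released at time \<open>t\<close> is the head of an arc leaving
  one of \<open>\<pi>\<^sub>t\<^sub>+\<^sub>1, \<dots>, \<pi>\<^sub>n\<close>. By the choice of \<open>q\<close> there are fewer than \<open>m\<close> such arcs for \<open>t = q\<close>; as the
  degrees are non-increasing, each further time unit removes at least one of them until none is
  left. So the \<open>k\<close>-th operation on \<open>M\<^sub>2\<close> is released by time \<open>q + k - 1\<close>, and \<open>M\<^sub>2\<close> finishes by
  time \<open>q + m\<close>.
\<close>

text \<open>By induction on the size of \<open>S\<close>: the element with the latest start begins
  only after all others have completed, so adding it back extends the span by one. The offset
  \<open>a\<close> lets the same bound count time from \<open>0\<close>, from the first start on the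
  second machine, or from \<open>n\<close>.\<close>

lemma unit_separated_span:
  fixes s :: "'a \<Rightarrow> real"
  assumes "finite S" "S \<noteq> {}" "\<And>i. i \<in> S \<Longrightarrow> a \<le> s i"
    and "\<And>i j. i \<in> S \<Longrightarrow> j \<in> S \<Longrightarrow> i \<noteq> j \<Longrightarrow> s i + 1 \<le> s j \<or> s j + 1 \<le> s i"
  shows "\<exists>i\<in>S. a + card S \<le> s i + 1"
  using assms
proof (induction "card S" arbitrary: S)
  case 0
  then show ?case by simp
next
  case (Suc c)
  have "Max (s ` S) \<in> s ` S" using Suc.prems by simp
  then obtain i where i: "i \<in> S" "s i = Max (s ` S)" by auto
  have max: "s j \<le> s i" if "j \<in> S" for j using that i Suc.prems by simp
  have card: "card S = Suc (card (S - {i}))" using i(1) Suc.prems(1) by (rule card.remove[rotated])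
  show ?case
  proof (cases "S - {i} = {}")
    case True
    then have "card S = 1" using card by (simp only: card.empty)
    then show ?thesis using Suc.prems(3)[OF i(1)] i(1) by force
  next
    case False
    then obtain j where j: "j \<in> S - {i}" "a + card (S - {i}) \<le> s j + 1"
      using Suc.hyps(1)[of "S - {i}"] Suc.hyps(2) Suc.prems card by auto
    have "s j + 1 \<le> s i" using Suc.prems(4)[of i j] max[of j] i(1) j(1) by force
    then have "a + card S \<le> s i + 1" using j(2) card by simp
    then show ?thesis using i(1) by blast
  qed
qed

lemma machine_ok_span:
  assumes "machine_ok k s" "S \<subseteq> {1..k}" "S \<noteq> {}" "\<And>i. i \<in> S \<Longrightarrow> a \<le> s i"
  shows "\<exists>i\<in>S. a + card S \<le> s i + 1"
proof (rule unit_separated_span)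
  show "finite S" using assms(2) finite_subset by blast
  show "s i + 1 \<le> s j \<or> s j + 1 \<le> s i" if "i \<in> S" "j \<in> S" "i \<noteq> j" for i j
    using assms(1,2) that unfolding machine_ok_def by blast
qed (use assms in auto)

lemma Cmax_le_iff:
  assumes "1 \<le> n" "1 \<le> m"
  shows "Cmax n m sA sB \<le> c \<longleftrightarrow> (\<forall>i\<in>{1..n}. sA i + 1 \<le> c) \<and> (\<forall>j\<in>{1..m}. sB j + 1 \<le> c)"
  using assms by (auto simp: Cmax_def)

lemma Cmax_ge_m_plus_dminB:
  assumes inst: "cd_instance n m E" and feas: "feasible n m E sA sB"
  shows "real (m + dminB m E) \<le> Cmax n m sA sB"
proof -
  have nm: "1 \<le> n" "1 \<le> m" and E: "E \<subseteq> {1..n} \<times> {1..m}"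
    using inst by (auto simp: cd_instance_def)
  have okA: "machine_ok n sA" and okB: "machine_ok m sB"
    and prec: "(i, j) \<in> E \<Longrightarrow> sA i + 1 \<le> sB j" for i j
    using feas by (auto simp: feasible_def)
  \<comment> \<open>The first operation to start on the second machine: all \<open>m\<close>
    operations run from \<open>sB j\<close> on, so the makespan is at least
    \<open>sB j + m\<close>.\<close>
  have "Min (sB ` {1..m}) \<in> sB ` {1..m}" using nm by (intro Min_in) auto
  then obtain j where j: "j \<in> {1..m}" "sB j = Min (sB ` {1..m})" by auto
  have "real (degB E j) \<le> sB j"
  proof (cases "preds E j = {}")
    case True
    then show ?thesis using okB j(1) by (simp add: degB_def machine_ok_def)
  next
    case False
    have sub: "preds E j \<subseteq> {1..n}" using E by (auto simp: preds_def)
    obtain i where "i \<in> preds E j" "0 + card (preds E j) \<le> sA i + 1"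
      using machine_ok_span[OF okA sub False, of 0] okA sub by (force simp: machine_ok_def)
    then show ?thesis using prec[of i j] by (simp add: degB_def preds_def)
  qed
  moreover have "dminB m E \<le> degB E j" using j(1) by (simp add: dminB_def)
  moreover obtain k where "k \<in> {1..m}" "sB j + card {1..m} \<le> sB k + 1"
    using machine_ok_span[OF okB, of "{1..m}" "sB j"] j(2) nm by auto
  moreover have "sB k + 1 \<le> Cmax n m sA sB" if "k \<in> {1..m}" for k
    using that Cmax_le_iff[OF nm] by blast
  ultimately show ?thesis by fastforce
qed

lemma Cmax_ge_n_plus_dminA:
  assumes inst: "cd_instance n m E" and feas: "feasible n m E sA sB"
  shows "real (n + dminA n E) \<le> Cmax n m sA sB"
proof -
  have nm: "1 \<le> n" "1 \<le> m" and E: "E \<subseteq> {1..n} \<times> {1..m}"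
    using inst by (auto simp: cd_instance_def)
  have okA: "machine_ok n sA" and okB: "machine_ok m sB"
    and prec: "(i, j) \<in> E \<Longrightarrow> sA i + 1 \<le> sB j" for i j
    using feas by (auto simp: feasible_def)
  \<comment> \<open>An operation of the first machine that completes at time \<open>n\<close> or
    later. All its successors start at \<open>n\<close> or later, so the span bound applies to them
    with offset \<open>n\<close>.\<close>
  obtain i where i: "i \<in> {1..n}" "n \<le> sA i + 1"
    using machine_ok_span[OF okA, of "{1..n}" 0] okA nm by (auto simp: machine_ok_def)
  have "real (n + degA E i) \<le> Cmax n m sA sB"
  proof (cases "succs E i = {}")
    case True
    have "sA i + 1 \<le> Cmax n m sA sB" using i(1) Cmax_le_iff[OF nm] by blast
    then show ?thesis using i(2) True by (simp add: degA_def)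
  next
    case False
    have sub: "succs E i \<subseteq> {1..m}" using E by (auto simp: succs_def)
    have "real n \<le> sB j" if "j \<in> succs E i" for j
      using prec[of i j] that i(2) by (simp add: succs_def)
    then obtain j where j: "j \<in> succs E i" "n + card (succs E i) \<le> sB j + 1"
      using machine_ok_span[OF okB sub False, of "real n"] by auto
    have "sB j + 1 \<le> Cmax n m sA sB" using j(1) sub Cmax_le_iff[OF nm] by blast
    then show ?thesis using j(2) by (simp add: degA_def)
  qed
  moreover have "dminA n E \<le> degA E i" using i(1) by (simp add: dminA_def)
  ultimately show ?thesis by simp
qed

text \<open>Passing from \<open>k\<close> to \<open>k + 1\<close> drops the largest term of the
  tail. If that term is positive, the sum falls by at least one, which pays for the larger
  \<open>k\<close>; if it is zero, the rest of the tail vanishes, hence the second disjunct.\<close>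

lemma antimono_tail_sum:
  fixes d :: "nat \<Rightarrow> nat"
  assumes anti: "\<And>a b. 1 \<le> a \<Longrightarrow> a < b \<Longrightarrow> b \<le> n \<Longrightarrow> d b \<le> d a"
    and tail: "(\<Sum>i\<in>{q<..n}. d i) < m"
  shows "(\<Sum>i\<in>{q + k<..n}. d i) + k < m \<or> (\<Sum>i\<in>{q + k<..n}. d i) = 0"
proof (induction k)
  case 0
  then show ?case using tail by simp
next
  case (Suc k)
  show ?case
  proof (cases "q + k < n")
    case False
    then show ?thesis by simp
  next
    case True
    then have "{q + k<..n} = insert (Suc (q + k)) {q + Suc k<..n}" by auto
    then have split: "(\<Sum>i\<in>{q + k<..n}. d i) = d (Suc (q + k)) + (\<Sum>i\<in>{q + Suc k<..n}. d i)"
      by simp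
    show ?thesis
    proof (cases "d (Suc (q + k)) = 0")
      case True
      have "d i = 0" if "i \<in> {q + Suc k<..n}" for i
        using anti[of "Suc (q + k)" i] that True by simp
      then show ?thesis by simp
    next
      case False
      then show ?thesis using Suc.IH split by linarith
    qed
  qed
qed

lemma q_index_props:
  assumes "1 \<le> n" "1 \<le> m"
  shows "q_index n m E \<pi> \<in> {1..n}"
    and "(\<Sum>i\<in>{q_index n m E \<pi><..n}. degA E (\<pi> i)) < m"
proof -
  let ?q = "q_index n m E \<pi>" and ?d = "\<lambda>i. degA E (\<pi> i)"
  have q: "?q \<in> {1..n} \<and> (\<Sum>i=1..?q. int (?d i)) > (\<Sum>i=1..n. int (?d i)) - int m"
    \<comment> \<open>The witness \<open>n\<close> works because the full sum exceeds itself minus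
      \<open>m\<close>.\<close>
    unfolding q_index_def by (rule LeastI[of _ n]) (use assms in auto)
  then show "?q \<in> {1..n}" by blast
  have "{1..n} = {1..?q} \<union> {?q<..n}" using q by auto
  then have "(\<Sum>i=1..n. int (?d i)) = (\<Sum>i=1..?q. int (?d i)) + (\<Sum>i\<in>{?q<..n}. int (?d i))"
    by (simp only:, intro sum.union_disjoint) auto
  then have "(\<Sum>i\<in>{?q<..n}. int (?d i)) < int m" using q by linarith
  then show "(\<Sum>i\<in>{?q<..n}. ?d i) < m" by (simp flip: of_nat_sum)
qed

text \<open>If all predecessors occupied the first \<open>t\<close> positions of
  \<open>\<pi>\<close>, both terms of the release time would be at most \<open>t\<close>: the one in
  position \<open>p\<close> completes at time \<open>p\<close>, and there are at most
  \<open>t\<close> of them.\<close>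

lemma late_release_imp_late_pred:
  assumes E: "E \<subseteq> {1..n} \<times> {1..m}" and bij: "bij_betw \<pi> {1..n} {1..n}"
    and sA: "\<forall>i\<in>{1..n}. sA (\<pi> i) = real i - 1"
    and late: "real t < release E sA j"
  shows "\<exists>p\<in>{t<..n}. j \<in> succs E (\<pi> p)"
proof (rule ccontr)
  assume early: "\<not> ?thesis"
  have ne: "preds E j \<noteq> {}" using late by (auto simp: release_def)
  have pos: "\<exists>p\<in>{1..t}. i = \<pi> p \<and> sA i + 1 = real p" if "i \<in> preds E j" for i
  proof -
    have "i \<in> \<pi> ` {1..n}" using that E bij by (auto simp: preds_def bij_betw_def)
    then obtain p where p: "p \<in> {1..n}" "i = \<pi> p" by blast
    moreover have "p \<le> t" using early that p by (force simp: preds_def succs_def)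
    ultimately show ?thesis using sA by auto
  qed
  have "preds E j \<subseteq> \<pi> ` {1..t}" using pos by blast
  then have fin: "finite (preds E j)" and "card (preds E j) \<le> card (\<pi> ` {1..t})"
    by (auto intro: finite_subset card_mono)
  then have "degB E j \<le> t" using card_image_le[of "{1..t}" \<pi>] by (simp add: degB_def)
  moreover have "Max ((\<lambda>i. sA i + 1) ` preds E j) \<le> real t" using fin ne pos by (subst Max_le_iff) force+
  ultimately show False using late ne by (simp add: release_def)
qed

lemma card_late_release_le:
  assumes E: "E \<subseteq> {1..n} \<times> {1..m}" and "bij_betw \<pi> {1..n} {1..n}"
    and "\<forall>i\<in>{1..n}. sA (\<pi> i) = real i - 1"
  shows "card {j. real t < release E sA j} \<le> (\<Sum>i\<in>{t<..n}. degA E (\<pi> i))"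
    and "finite {j. real t < release E sA j}"
proof -
  \<comment> \<open>Union bound: every late operation is the head of an arc that leaves a position
    after \<open>t\<close>.\<close>
  let ?U = "\<Union>i\<in>{t<..n}. succs E (\<pi> i)"
  have sub: "{j. real t < release E sA j} \<subseteq> ?U"
    using late_release_imp_late_pred[OF assms] by fast
  have "succs E i \<subseteq> {1..m}" for i using E by (auto simp: succs_def)
  then have fin: "finite ?U" by (meson UN_least finite_atLeastAtMost finite_subset)
  show "finite {j. real t < release E sA j}" using sub fin by (rule finite_subset)
  have "card {j. real t < release E sA j} \<le> card ?U" using fin sub by (rule card_mono)
  also have "\<dots> \<le> (\<Sum>i\<in>{t<..n}. degA E (\<pi> i))"
    unfolding degA_def by (rule card_UN_le) simp
  finally show "card {j. real t < release E sA j} \<le> (\<Sum>i\<in>{t<..n}. degA E (\<pi> i))" .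
qed

lemma Cmax_Gr_le:
  assumes inst: "cd_instance n m E" and gr: "Gr_schedule n m E \<pi> sA sB"
  shows "Cmax n m sA sB \<le> real (max (q_index n m E \<pi> + m) n)"
proof -
  define q where "q = q_index n m E \<pi>"
  have nm: "1 \<le> n" "1 \<le> m" and E: "E \<subseteq> {1..n} \<times> {1..m}"
    using inst by (auto simp: cd_instance_def)
  have bij: "bij_betw \<pi> {1..n} {1..n}"
    and anti: "\<And>a b. 1 \<le> a \<Longrightarrow> a < b \<Longrightarrow> b \<le> n \<Longrightarrow> degA E (\<pi> b) \<le> degA E (\<pi> a)"
    and sA: "\<forall>i\<in>{1..n}. sA (\<pi> i) = real i - 1"
    using gr by (auto simp: Gr_schedule_def Gr_order_def)
  obtain \<sigma> where sigma: "bij_betw \<sigma> {1..m} {1..m}"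
    and sorted: "\<And>a b. a \<in> {1..m} \<Longrightarrow> b \<in> {1..m} \<Longrightarrow> a < b \<Longrightarrow>
      release E sA (\<sigma> a) \<le> release E sA (\<sigma> b)"
    and sB: "\<And>k. k \<in> {1..m} \<Longrightarrow> sB (\<sigma> k) =
      max (release E sA (\<sigma> k)) (if k = 1 then 0 else sB (\<sigma> (k - 1)) + 1)"
    using gr unfolding Gr_schedule_def Gr_scheduleB_def by blast
  have released: "release E sA (\<sigma> (Suc k)) \<le> real (q + k)" if "Suc k \<le> m" for k
  proof (rule ccontr)
    assume late: "\<not> ?thesis"
    let ?L = "{j. real (q + k) < release E sA j}"
    \<comment> \<open>Since \<open>\<sigma>\<close> sorts by release time, one late operation makes
      all later ones late, which gives \<open>m - k\<close> late operations at time
      \<open>q + k\<close>.\<close>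
    have "\<sigma> ` {Suc k..m} \<subseteq> ?L"
    proof clarify
      fix b assume "b \<in> {Suc k..m}"
      then show "real (q + k) < release E sA (\<sigma> b)"
        using late sorted[of "Suc k" b] by (cases "b = Suc k") auto
    qed
    moreover have "inj_on \<sigma> {Suc k..m}"
      using sigma by (auto simp: bij_betw_def intro: inj_on_subset)
    ultimately have "card {Suc k..m} \<le> card ?L"
      using card_late_release_le(2)[OF E bij sA] by (metis card_image card_mono)
    also have "\<dots> \<le> (\<Sum>i\<in>{q + k<..n}. degA E (\<pi> i))"
      by (rule card_late_release_le(1)[OF E bij sA])
    finally have "m - k \<le> (\<Sum>i\<in>{q + k<..n}. degA E (\<pi> i))" by simp
    \<comment> \<open>Either alternative contradicts the count: the first leaves fewer than
      \<open>m - k\<close> arcs, the second none although \<open>m - k\<close> is positive.\<close>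
    moreover have "(\<Sum>i\<in>{q + k<..n}. degA E (\<pi> i)) + k < m \<or>
        (\<Sum>i\<in>{q + k<..n}. degA E (\<pi> i)) = 0"
      using anti q_index_props(2)[OF nm] unfolding q_def by (rule antimono_tail_sum)
    ultimately show False using that by linarith
  qed
  \<comment> \<open>The machine is free in time: an operation started by \<open>q + k\<close>
    completes by \<open>q + k + 1\<close>, which is exactly the release bound for the next
    one.\<close>
  have start: "sB (\<sigma> (Suc k)) \<le> real (q + k)" if "Suc k \<le> m" for k
    using that
  proof (induction k)
    case 0
    then show ?case using sB[of 1] released[of 0] by simp
  next
    case (Suc k)
    then show ?case using sB[of "Suc (Suc k)"] released[of "Suc k"] by simp
  qed
  have "sB j + 1 \<le> real (q + m)" if "j \<in> {1..m}" for j
  proof -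
    have "j \<in> \<sigma> ` {1..m}" using that sigma by (simp add: bij_betw_def)
    then obtain k where "k \<in> {1..m}" "j = \<sigma> k" by blast
    then show ?thesis using start[of "k - 1"] by auto
  qed
  moreover have "sA i + 1 \<le> real n" if "i \<in> {1..n}" for i
  proof -
    have "i \<in> \<pi> ` {1..n}" using that bij by (simp add: bij_betw_def)
    then obtain p where "p \<in> {1..n}" "i = \<pi> p" by blast
    then show ?thesis using sA by simp
  qed
  ultimately show ?thesis unfolding Cmax_le_iff[OF nm] q_def by fastforce
qed

theorem mainTheorem1:
  fixes n m :: nat and E :: "(nat \<times> nat) set" and \<pi> :: "nat \<Rightarrow> nat"
    and sA sB sA_opt sB_opt :: "nat \<Rightarrow> real"
  assumes "cd_instance n m E"
    and "optimal n m E sA_opt sB_opt"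
    and "Gr_schedule n m E \<pi> sA sB"
  shows "Cmax n m sA sB / Cmax n m sA_opt sB_opt \<le>
    real (max (q_index n m E \<pi> + m) n) / real (max (m + dminB m E) (n + dminA n E))"
proof (rule frac_le)
  have feas: "feasible n m E sA_opt sB_opt" using assms(2) by (simp add: optimal_def)
  show "real (max (m + dminB m E) (n + dminA n E)) \<le> Cmax n m sA_opt sB_opt"
    using Cmax_ge_m_plus_dminB[OF assms(1) feas] Cmax_ge_n_plus_dminA[OF assms(1) feas] by simp
  show "0 < real (max (m + dminB m E) (n + dminA n E))"
    using assms(1) by (auto simp: cd_instance_def)
qed (use Cmax_Gr_le[OF assms(1,3)] in simp_all)

end
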